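(* Let $N=\{1,2,\ldots,n\}$. (1) For every $\mathrm{L}_2$-convex set $S\subseteq\mathbb{Z}^n$ there exist $\gamma_{IJ}\in\mathbb{Z}\cup\{+\infty\}$, indexed by the pairs $(I,J)$ of subsets of $N$ with $|I|=|J|$ and $I\cap J=\emptyset$, such that $$S=\{x\in\mathbb{Z}^n \mid x(J)-x(I)\le\gamma_{IJ}\ \text{ for all } (I,J) \text{ with } |I|=|J|,\ I\cap J=\emptyset\}.$$ (2) For every $\mathrm{L}_2$-convex polyhedron $P\subseteq\mathbb{R}^n$ there exist $\gamma_{IJ}\in\mathbb{R}\cup\{+\infty\}$, indexed by the same pairs $(I,J)$, such that $$P=\{x\in\mathbb{R}^n \mid x(J)-x(I)\le\gamma_{IJ}\ \text{ for all } (I,J) \text{ with } |I|=|J|,\ I\cap J=\emptyset\}.$$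
   Context: For a vector $x=(x_1,\ldots,x_n)$ and $I\subseteq N$, $x(I)=\sum_{i\in I}x_i$. The vectors $x\vee y$ and $x\wedge y$ are the componentwise maximum and minimum, and $\mathbf{1}=(1,\ldots,1)$. A nonempty set $S\subseteq\mathbb{Z}^n$ is called L-convex if (i) $x,y\in S$ implies $x\vee y,\ x\wedge y\in S$, and (ii) $x\in S$, $\mu\in\mathbb{Z}$ implies $x+\mu\mathbf{1}\in S$. A nonempty polyhedron $P\subseteq\mathbb{R}^n$ is called L-convex if (i) $x,y\in P$ implies $x\vee y,\ x\wedge y\in P$, and (ii) $x\in P$, $\mu\in\mathbb{R}$ implies $x+\mu\mathbf{1}\in P$. A set $S\subseteq\mathbb{Z}^n$ is called $\mathrm{L}_2$-convex if $S=S_1+S_2=\{y+z\mid y\in S_1,\ z\in S_2\}$ for some L-convex sets $S_1,S_2\subseteq\mathbb{Z}^n$. A polyhedron $P\subseteq\mathbb{R}^n$ is called $\mathrm{L}_2$-convex if it is the Minkowski sum $P_1+P_2$ of two L-convex polyhedra $P_1,P_2\subseteq\mathbb{R}^n$. *)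

theory Defs
  imports "HOL-Analysis.Analysis"
begin

text \<open>The index set \<open>N\<close> is the universe of a type \<open>'n\<close> of class \<open>finite\<close>, so \<open>n = CARD('n)\<close>.\<close>

definition vjoin :: "'a::linorder ^ 'n \<Rightarrow> 'a ^ 'n \<Rightarrow> 'a ^ 'n" where
  "vjoin x y = (\<chi> i. max (x $ i) (y $ i))"

definition vmeet :: "'a::linorder ^ 'n \<Rightarrow> 'a ^ 'n \<Rightarrow> 'a ^ 'n" where
  "vmeet x y = (\<chi> i. min (x $ i) (y $ i))"

text \<open>The library instantiates \<^const>\<open>sup\<close> and \<^const>\<open>inf\<close> for real but not for integer
  vectors; on real vectors \<^const>\<open>vjoin\<close> and \<^const>\<open>vmeet\<close> agree with them.\<close>

lemma vjoin_real_eq_sup: "vjoin x y = sup x (y :: real ^ 'n)"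
  by (simp add: vjoin_def sup_vec_def sup_max)

lemma vmeet_real_eq_inf: "vmeet x y = inf x (y :: real ^ 'n)"
  by (simp add: vmeet_def inf_vec_def inf_min)

definition coord_sum :: "'a::comm_monoid_add ^ 'n \<Rightarrow> 'n set \<Rightarrow> 'a" where
  "coord_sum x I = (\<Sum>i\<in>I. x $ i)"

definition L_convex_set :: "(int ^ 'n) set \<Rightarrow> bool" where
  "L_convex_set S \<longleftrightarrow>
     S \<noteq> {} \<and>
     (\<forall>x\<in>S. \<forall>y\<in>S. vjoin x y \<in> S \<and> vmeet x y \<in> S) \<and>
     (\<forall>x\<in>S. \<forall>\<mu>::int. x + \<mu> *s 1 \<in> S)"

definition L_convex_polyhedron :: "(real ^ 'n) set \<Rightarrow> bool" where
  "L_convex_polyhedron P \<longleftrightarrow>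
     polyhedron P \<and> P \<noteq> {} \<and>
     (\<forall>x\<in>P. \<forall>y\<in>P. vjoin x y \<in> P \<and> vmeet x y \<in> P) \<and>
     (\<forall>x\<in>P. \<forall>\<mu>::real. x + \<mu> *s 1 \<in> P)"

text \<open>Below, \<open>+\<close> on sets is the Minkowski sum.\<close>

definition L2_convex_set :: "(int ^ 'n) set \<Rightarrow> bool" where
  "L2_convex_set S \<longleftrightarrow>
     (\<exists>S1 S2. L_convex_set S1 \<and> L_convex_set S2 \<and> S = S1 + S2)"

definition L2_convex_polyhedron :: "(real ^ 'n) set \<Rightarrow> bool" where
  "L2_convex_polyhedron P \<longleftrightarrow>
     polyhedron P \<and>
     (\<exists>P1 P2. L_convex_polyhedron P1 \<and> L_convex_polyhedron P2 \<and> P = P1 + P2)"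

end

theory Submission
  imports Defs
begin

text \<open>
  An L-convex set (closed, in the real case) is the solution set of difference constraints
  \<open>x\<^sub>j - x\<^sub>i \<le> a\<^sub>i\<^sub>j\<close>. Hence \<open>x \<in> S1 + S2\<close> means that some \<open>y\<close> satisfies \<open>y\<^sub>j - y\<^sub>i \<le> a\<^sub>i\<^sub>j\<close> and
  \<open>y\<^sub>i - y\<^sub>j \<le> b\<^sub>i\<^sub>j + x\<^sub>i - x\<^sub>j\<close>, a system that is infeasible only if its constraint graph has a
  negative simple cycle. Let \<open>\<sigma>\<close> be the successor map of such a cycle and \<open>B\<close> the set of its
  vertices whose outgoing arc comes from \<open>S2\<close>. Negativity says that \<open>x(B) - x(\<sigma> B)\<close> exceeds a
  sum of the bounds \<open>a\<close>, \<open>b\<close> which is an upper bound of \<open>s(B) - s(\<sigma> B)\<close> over \<open>s \<in> S1 + S2\<close>.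
  Cancelling \<open>B \<inter> \<sigma> B\<close> turns this into a violated inequality for the pair
  \<open>I = \<sigma> B - B\<close>, \<open>J = B - \<sigma> B\<close>.
\<close>

section \<open>Simple paths, cycles and shortest-path potentials\<close>

fun path_cost :: "('n \<Rightarrow> 'n \<Rightarrow> 'a::monoid_add) \<Rightarrow> 'n list \<Rightarrow> 'a" where
  "path_cost c (u # v # p) = c u v + path_cost c (v # p)"
| "path_cost c _ = 0"

lemma path_cost_append:
  "path_cost c (p @ v # q) = path_cost c (p @ [v]) + path_cost c (v # q)"
proof (induction p)
  case (Cons u p)
  then show ?case by (cases p) (auto simp: add.assoc)
qed auto

lemma path_cost_snoc: "p \<noteq> [] \<Longrightarrow> path_cost c (p @ [v]) = path_cost c p + c (last p) v"
  by (cases p rule: rev_cases) (simp_all add: path_cost_append[of c _ _ "[v]"])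

text \<open>For \<open>w = u\<close> the path closes up to a cycle and \<open>\<sigma>\<close>
  permutes its vertices. Leaving \<open>w\<close> free lets the induction drop the head of the path,
  after which \<open>w\<close> lies off the remaining path.\<close>

lemma path_successor_map:
  fixes c :: "'n \<Rightarrow> 'n \<Rightarrow> 'a::comm_monoid_add"
  assumes "distinct (u # p)" "w \<notin> set p" "successively E (u # p)" "E (last (u # p)) w"
  shows "\<exists>\<sigma>. bij_betw \<sigma> (set (u # p)) (insert w (set p)) \<and> (\<forall>v\<in>set (u # p). E v (\<sigma> v)) \<and>
    (\<Sum>v\<in>set (u # p). c v (\<sigma> v)) = path_cost c (u # p) + c (last (u # p)) w"
  using assms
proof (induction p arbitrary: u)
  case Nil
  then show ?case by (intro exI[of _ "\<lambda>_. w"]) (auto simp: bij_betw_def)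
next
  case (Cons t p)
  have t: "distinct (t # p)" "w \<notin> set p" "successively E (t # p)" "E (last (t # p)) w"
    and u: "u \<notin> set (t # p)" "E u t" and "t \<notin> insert w (set p)"
    using Cons.prems by auto
  obtain \<sigma> where \<sigma>: "bij_betw \<sigma> (set (t # p)) (insert w (set p))"
    "\<forall>v\<in>set (t # p). E v (\<sigma> v)"
    "(\<Sum>v\<in>set (t # p). c v (\<sigma> v)) = path_cost c (t # p) + c (last (t # p)) w"
    using Cons.IH[OF t] by blast
  let ?\<sigma> = "\<sigma>(u := t)"
  have eq: "?\<sigma> v = \<sigma> v" if "v \<in> set (t # p)" for v
    using that u(1) by auto
  have "bij_betw ?\<sigma> (set (t # p)) (insert w (set p))"
    using \<sigma>(1) eq bij_betw_cong by blast
  then have "bij_betw ?\<sigma> (insert u (set (t # p))) (insert t (insert w (set p)))"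
    using u(1) \<open>t \<notin> insert w (set p)\<close> notIn_Un_bij_betw[of u "set (t # p)" ?\<sigma> "insert w (set p)"]
    by simp
  moreover have "insert t (insert w (set p)) = insert w (set (t # p))"
    by auto
  moreover have "(\<Sum>v\<in>insert u (set (t # p)). c v (?\<sigma> v)) = c u t + (\<Sum>v\<in>set (t # p). c v (\<sigma> v))"
    using u(1) eq by (subst sum.insert) (auto intro!: sum.cong)
  ultimately have "bij_betw ?\<sigma> (set (u # t # p)) (insert w (set (t # p)))"
    and "(\<Sum>v\<in>set (u # t # p). c v (?\<sigma> v))
      = path_cost c (u # t # p) + c (last (u # t # p)) w"
    using \<sigma>(3) by (simp_all add: add.assoc)
  moreover have "\<forall>v\<in>set (u # t # p). E v (?\<sigma> v)"
    using u \<sigma>(2) by auto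
  ultimately show ?case
    by blast
qed

lemma feasible_potential:
  fixes c :: "'n::finite \<Rightarrow> 'n \<Rightarrow> 'a::linordered_ab_group_add"
  assumes cycle: "\<And>V \<sigma>. bij_betw \<sigma> V V \<Longrightarrow> (\<And>v. v \<in> V \<Longrightarrow> E v (\<sigma> v)) \<Longrightarrow> 0 \<le> (\<Sum>v\<in>V. c v (\<sigma> v))"
  obtains y where "\<And>u v. E u v \<Longrightarrow> y v - y u \<le> c u v"
proof -
  define paths where
    "paths v = {p. p \<noteq> [] \<and> distinct p \<and> successively E p \<and> last p = v}" for v
  define y where "y v = Min (path_cost c ` paths v)" for v
  have fin: "finite (paths v)" for v
    by (rule finite_subset[OF _ finite_subset_distinct[of UNIV]]) (auto simp: paths_def)
  have y_le: "y v \<le> path_cost c p" if "p \<in> paths v" for p v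
    unfolding y_def using fin that by (intro Min_le) auto
  have y_attained: "\<exists>p\<in>paths v. y v = path_cost c p" for v
  proof -
    \<comment> \<open>The one-vertex path makes every set \<open>paths v\<close> nonempty, so the
      minimum is attained.\<close>
    have "[v] \<in> paths v"
      by (simp add: paths_def)
    then have "y v \<in> path_cost c ` paths v"
      unfolding y_def using fin by (intro Min_in) auto
    then show ?thesis by auto
  qed
  have "y v \<le> y u + c u v" if "E u v" for u v
  proof -
    obtain p where p: "p \<in> paths u" "y u = path_cost c p"
      using y_attained by blast
    show ?thesis
    proof (cases "v \<in> set p")
      case False
      then have "p @ [v] \<in> paths v"
        using p(1) that by (auto simp: paths_def successively_append_iff)
      then have "y v \<le> path_cost c (p @ [v])"
        by (rule y_le)
      also have "\<dots> = y u + c u v"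
        using p by (auto simp: path_cost_snoc paths_def)
      finally show ?thesis .
    next
      \<comment> \<open>Extending \<open>p\<close> by \<open>v\<close> would repeat
        \<open>v\<close>. The part of \<open>p\<close> from \<open>v\<close> on, closed by the arc
        from \<open>u\<close> to \<open>v\<close>, is a simple cycle of nonnegative cost; removing
        it leaves a path to \<open>v\<close> that costs no more.\<close>
      case True
      then obtain q r where qr: "p = q @ v # r"
        by (meson split_list)
      have r: "distinct (v # r)" "v \<notin> set r" "successively E (v # r)" "E (last (v # r)) v"
        using p(1) that qr by (auto simp: paths_def successively_append_iff)
      obtain \<sigma> where \<sigma>: "bij_betw \<sigma> (set (v # r)) (set (v # r))" "\<forall>t\<in>set (v # r). E t (\<sigma> t)"
        "(\<Sum>t\<in>set (v # r). c t (\<sigma> t)) = path_cost c (v # r) + c u v"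
        using path_successor_map[OF r, of c] p(1) qr by (auto simp: paths_def)
      have "0 \<le> (\<Sum>t\<in>set (v # r). c t (\<sigma> t))"
        by (rule cycle[OF \<sigma>(1)]) (rule bspec[OF \<sigma>(2)])
      then have nonneg: "0 \<le> path_cost c (v # r) + c u v"
        by (simp only: \<sigma>(3))
      have "q @ [v] \<in> paths v"
        using p(1) qr by (auto simp: paths_def successively_append_iff)
      then have "y v \<le> path_cost c (q @ [v])"
        by (rule y_le)
      from this nonneg have "y v + 0 \<le> path_cost c (q @ [v]) + (path_cost c (v # r) + c u v)"
        by (rule add_mono)
      also have "\<dots> = y u + c u v"
        unfolding p(2) qr path_cost_append[of c q v r] by (simp only: add.assoc)
      finally show ?thesis
        by simp
    qed
  qed
  then have "y v - y u \<le> c u v" if "E u v" for u v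
    using that by (simp add: diff_le_eq add.commute)
  then show thesis
    by (rule that)
qed

section \<open>Description of L-convex sets by difference constraints\<close>

lemma finite_vjoin_closed:
  assumes "finite A" "A \<noteq> {}" "\<And>a. a \<in> A \<Longrightarrow> Y a \<in> S"
    and "\<And>x y. x \<in> S \<Longrightarrow> y \<in> S \<Longrightarrow> vjoin x y \<in> S"
  shows "(\<chi> k. MAX a\<in>A. Y a $ k) \<in> S"
  using assms(1-3)
proof (induction A rule: finite_ne_induct)
  case (insert a A)
  have "(\<chi> k. MAX a\<in>insert a A. Y a $ k) = vjoin (Y a) (\<chi> k. MAX a\<in>A. Y a $ k)"
    using insert.hyps by (simp add: vjoin_def)
  then show ?case
    using insert by (simp add: assms(4))
qed simp

lemma finite_vmeet_closed:
  assumes "finite A" "A \<noteq> {}" "\<And>a. a \<in> A \<Longrightarrow> Y a \<in> S"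
    and "\<And>x y. x \<in> S \<Longrightarrow> y \<in> S \<Longrightarrow> vmeet x y \<in> S"
  shows "(\<chi> k. MIN a\<in>A. Y a $ k) \<in> S"
  using assms(1-3)
proof (induction A rule: finite_ne_induct)
  case (insert a A)
  have "(\<chi> k. MIN a\<in>insert a A. Y a $ k) = vmeet (Y a) (\<chi> k. MIN a\<in>A. Y a $ k)"
    using insert.hyps by (simp add: vmeet_def)
  then show ?case
    using insert by (simp add: assms(4))
qed simp

text \<open>
  The approximation hypothesis is topological closedness over the reals and is vacuous over the
  integers (take \<open>e = 1\<close>), so that both parts of the theorem are instances of one argument.
\<close>

definition L_closed ::
    "('a::{linordered_idom,conditionally_complete_linorder} ^ 'n) set \<Rightarrow> bool" where
  "L_closed S \<longleftrightarrow> S \<noteq> {} \<and>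
     (\<forall>x\<in>S. \<forall>y\<in>S. vjoin x y \<in> S \<and> vmeet x y \<in> S) \<and>
     (\<forall>x\<in>S. \<forall>\<mu>. x + \<mu> *s 1 \<in> S) \<and>
     (\<forall>x. (\<forall>e>0. \<exists>y\<in>S. \<forall>i. \<bar>y $ i - x $ i\<bar> < e) \<longrightarrow> x \<in> S)"

text \<open>Treats finite and infinite bounds alike: an unbounded \<open>X\<close> has elements
  above any value, so a condition on \<open>t\<close> is imposed only where \<open>Sup X\<close> is
  meaningful.\<close>

lemma less_Sup_if_bounded:
  fixes X :: "'a::{linordered_idom,conditionally_complete_linorder} set"
  assumes "X \<noteq> {}" and "bdd_above X \<Longrightarrow> t \<le> Sup X" and "0 < e"
  obtains s where "s \<in> X" "t - e < s"
proof (cases "bdd_above X")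
  case True
  then have "t - e < Sup X"
    using assms(2,3) by (simp add: less_le_trans)
  then show ?thesis
    using less_cSup_iff[OF assms(1) True] that by auto
next
  case False
  then have "\<not> (\<forall>s\<in>X. s \<le> t - e)"
    by (auto intro: bdd_aboveI)
  then show ?thesis
    using that by (auto simp: not_le)
qed

text \<open>The constraints are the tightest ones valid on \<open>S\<close>, with \<open>E\<close>
  marking the finite bounds. A point satisfying them is approximated by a meet of joins of elements
  of \<open>S\<close>, each adjusted to just two coordinates.\<close>

lemma L_closed_difference_constraints:
  fixes S :: "('a::{linordered_idom,conditionally_complete_linorder} ^ 'n) set"
  assumes "L_closed S"
  obtains E c where "S = {x. \<forall>i j. E i j \<longrightarrow> x $ j - x $ i \<le> c i j}"
proof -
  define E where "E i j \<longleftrightarrow> bdd_above ((\<lambda>x. x $ j - x $ i) ` S)" for i j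
  define c where "c i j = (SUP x\<in>S. x $ j - x $ i)" for i j
  have "x \<in> S" if x: "\<And>i j. E i j \<Longrightarrow> x $ j - x $ i \<le> c i j" for x
  proof -
    have "\<exists>w\<in>S. \<forall>k. \<bar>w $ k - x $ k\<bar> < e" if "0 < e" for e
    proof -
      have "\<exists>y\<in>S. y $ i = x $ i \<and> x $ j - e < y $ j" for i j
      proof -
        have "(\<lambda>x. x $ j - x $ i) ` S \<noteq> {}"
          using assms by (simp add: L_closed_def)
        then obtain s where s: "s \<in> S" "x $ j - x $ i - e < s $ j - s $ i"
          using less_Sup_if_bounded[OF _ x[unfolded E_def c_def] \<open>0 < e\<close>] by blast
        \<comment> \<open>Translation along \<open>1\<close> keeps all differences and makes
          coordinate \<open>i\<close> agree with \<open>x\<close>.\<close>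
        have "s + (x $ i - s $ i) *s 1 \<in> S"
          using assms s(1) unfolding L_closed_def by blast
        then show ?thesis
          using s(2) by (intro bexI[of _ "s + (x $ i - s $ i) *s 1"]) (simp_all add: algebra_simps)
      qed
      then obtain Y where Y: "\<And>i j. Y i j \<in> S" "\<And>i j. Y i j $ i = x $ i"
        "\<And>i j. x $ j - e < Y i j $ j"
        by metis
      \<comment> \<open>Each \<open>Z i\<close> exceeds \<open>x - e\<close> in every coordinate and
        equals \<open>x\<close> at \<open>i\<close>. The meet \<open>w\<close> keeps the lower
        bound, and its \<open>k\<close>-th coordinate is capped by that of
        \<open>Z k\<close>.\<close>
      define Z where "Z i = (\<chi> k. MAX j\<in>UNIV. Y i j $ k)" for i
      define w where "w = (\<chi> k. MIN i\<in>UNIV. Z i $ k)"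
      have "Z i \<in> S" for i
        unfolding Z_def using Y(1) assms by (intro finite_vjoin_closed) (auto simp: L_closed_def)
      then have w: "w \<in> S"
        unfolding w_def using assms by (intro finite_vmeet_closed) (auto simp: L_closed_def)
      have le: "w $ k \<le> x $ k" for k
      proof -
        have "w $ k \<le> Z k $ k"
          by (simp add: w_def)
        also have "Z k $ k = x $ k"
          by (simp add: Z_def Y(2))
        finally show ?thesis .
      qed
      have gt: "x $ k - e < w $ k" for k
      proof -
        have "x $ k - e < Z i $ k" for i
          using Y(3)[of k i] by (auto simp: Z_def Max_gr_iff)
        then show ?thesis
          by (auto simp: w_def)
      qed
      have "\<bar>w $ k - x $ k\<bar> < e" for k
        using le[of k] gt[of k] by (simp add: abs_of_nonpos algebra_simps)
      then show ?thesis
        using w by blast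
    qed
    then show ?thesis
      using assms by (auto simp: L_closed_def)
  qed
  moreover have "x $ j - x $ i \<le> c i j" if "x \<in> S" "E i j" for x i j
    using that unfolding E_def c_def by (intro cSUP_upper)
  ultimately show thesis
    by (intro that[of E c]) auto
qed

section \<open>Inequalities describing the Minkowski sum\<close>

lemma coord_sum_cancel:
  fixes x :: "'a::ab_group_add ^ 'n"
  assumes "inj_on \<sigma> B"
  shows "coord_sum x (B - \<sigma> ` B) - coord_sum x (\<sigma> ` B - B) = (\<Sum>v\<in>B. x $ v - x $ \<sigma> v)"
proof -
  have diff: "coord_sum x C = coord_sum x (C \<inter> D) + coord_sum x (C - D)" for C D
    unfolding coord_sum_def by (rule sum.Int_Diff) simp
  have "coord_sum x (B - \<sigma> ` B) - coord_sum x (\<sigma> ` B - B) = coord_sum x B - coord_sum x (\<sigma> ` B)"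
    unfolding diff[of B "\<sigma> ` B"] diff[of "\<sigma> ` B" B] Int_commute[of "\<sigma> ` B" B] by simp
  then show ?thesis
    unfolding coord_sum_def using assms by (simp add: sum.reindex sum_subtractf)
qed

text \<open>The right-hand sides \<open>g\<close> are the suprema over the sum itself, and
  \<open>D\<close> marks where they are finite. Validity is then immediate; the work is to split a
  point satisfying all inequalities into two summands.\<close>

lemma L_closed_sum_description:
  fixes S1 S2 :: "('a::{linordered_idom,conditionally_complete_linorder} ^ 'n) set"
  assumes "L_closed S1" "L_closed S2"
  obtains D g where "S1 + S2 = {x. \<forall>I J. card I = card J \<and> I \<inter> J = {} \<longrightarrow> D I J \<longrightarrow>
    coord_sum x J - coord_sum x I \<le> g I J}"
proof -
  define D where "D I J \<longleftrightarrow> bdd_above ((\<lambda>s. coord_sum s J - coord_sum s I) ` (S1 + S2))" for I J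
  define g where "g I J = (SUP s\<in>S1 + S2. coord_sum s J - coord_sum s I)" for I J
  obtain a b where "a \<in> S1" "b \<in> S2"
    using assms unfolding L_closed_def by blast
  then have nonempty: "S1 + S2 \<noteq> {}"
    using set_plus_intro by blast
  obtain E1 c1 where S1: "S1 = {x. \<forall>i j. E1 i j \<longrightarrow> x $ j - x $ i \<le> c1 i j}"
    using L_closed_difference_constraints[OF assms(1)] .
  obtain E2 c2 where S2: "S2 = {x. \<forall>i j. E2 i j \<longrightarrow> x $ j - x $ i \<le> c2 i j}"
    using L_closed_difference_constraints[OF assms(2)] .
  have complete: "x \<in> S1 + S2"
    if x: "\<And>I J. card I = card J \<Longrightarrow> I \<inter> J = {} \<Longrightarrow> D I J \<Longrightarrow>
      coord_sum x J - coord_sum x I \<le> g I J" for x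
  proof -
    \<comment> \<open>\<open>d u v\<close> is the bound on \<open>y v - y u\<close> that results
      from requiring \<open>x - y\<close> to lie in \<open>S2\<close>. Where both sets supply an arc
      from \<open>u\<close> to \<open>v\<close>, \<open>A\<close> selects the cheaper one.\<close>
    define d where "d u v = c2 v u + (x $ v - x $ u)" for u v
    define A where "A u v \<longleftrightarrow> E1 u v \<and> (E2 v u \<longrightarrow> c1 u v \<le> d u v)" for u v
    define E where "E u v \<longleftrightarrow> E1 u v \<or> E2 v u" for u v
    define c where "c u v = (if A u v then c1 u v else d u v)" for u v
    have "0 \<le> (\<Sum>v\<in>V. c v (\<sigma> v))" if \<sigma>: "bij_betw \<sigma> V V" and E: "\<And>v. v \<in> V \<Longrightarrow> E v (\<sigma> v)" for V \<sigma>
    proof -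
      define B where "B = {v \<in> V. \<not> A v (\<sigma> v)}"
      define K where "K = (\<Sum>v\<in>V - B. c1 v (\<sigma> v)) + (\<Sum>v\<in>B. c2 (\<sigma> v) v)"
      have "B \<subseteq> V"
        by (auto simp: B_def)
      then have inj: "inj_on \<sigma> B"
        using \<sigma> by (meson bij_betw_def inj_on_subset)
      have split: "sum f V = sum f (V - B) + sum f B" for f :: "'n \<Rightarrow> 'a"
        using \<open>B \<subseteq> V\<close> by (rule sum.subset_diff) simp
      have bound: "(\<Sum>v\<in>B. s $ v - s $ \<sigma> v) \<le> K" if mem: "s \<in> S1 + S2" for s
      proof -
        obtain y z where s: "s = y + z" "y \<in> S1" "z \<in> S2"
          using mem by (rule set_plus_elim)
        \<comment> \<open>Since \<open>\<sigma>\<close> permutes \<open>V\<close>, the sum for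
          \<open>y\<close> over \<open>B\<close> can be traded for one over \<open>V - B\<close>,
          where the bounds of \<open>S1\<close> apply; the bounds of \<open>S2\<close> handle
          \<open>z\<close> on \<open>B\<close> directly.\<close>
        have "(\<Sum>v\<in>V. y $ \<sigma> v - y $ v) = 0"
          by (simp add: sum_subtractf sum.reindex_bij_betw[OF \<sigma>, of "\<lambda>v. y $ v"])
        then have "(\<Sum>v\<in>B. y $ v - y $ \<sigma> v) = (\<Sum>v\<in>V - B. y $ \<sigma> v - y $ v)"
          unfolding split by (simp add: sum_subtractf algebra_simps)
        also have "\<dots> \<le> (\<Sum>v\<in>V - B. c1 v (\<sigma> v))"
          using s(2) by (intro sum_mono) (auto simp: S1 B_def A_def)
        finally have "(\<Sum>v\<in>B. y $ v - y $ \<sigma> v) \<le> (\<Sum>v\<in>V - B. c1 v (\<sigma> v))" .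
        moreover have "(\<Sum>v\<in>B. z $ v - z $ \<sigma> v) \<le> (\<Sum>v\<in>B. c2 (\<sigma> v) v)"
          using s(3) E by (intro sum_mono) (auto simp: S2 B_def A_def E_def)
        moreover have "(\<Sum>v\<in>B. s $ v - s $ \<sigma> v)
            = (\<Sum>v\<in>B. y $ v - y $ \<sigma> v) + (\<Sum>v\<in>B. z $ v - z $ \<sigma> v)"
          unfolding s(1) by (simp flip: sum.distrib add: algebra_simps)
        ultimately show ?thesis
          unfolding K_def by (simp add: add_mono)
      qed
      define I where "I = \<sigma> ` B - B"
      define J where "J = B - \<sigma> ` B"
      have eq: "coord_sum s J - coord_sum s I = (\<Sum>v\<in>B. s $ v - s $ \<sigma> v)" for s :: "'a ^ 'n"
        unfolding I_def J_def by (rule coord_sum_cancel[OF inj])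
      have "card I = card J"
        unfolding I_def J_def using card_image[OF inj] by (simp add: card_Diff_subset_Int Int_commute)
      moreover have "I \<inter> J = {}"
        by (auto simp: I_def J_def)
      \<comment> \<open>The bound \<open>K\<close> makes the supremum for this pair finite, so the
        hypothesis on \<open>x\<close> applies, and also gives \<open>g I J \<le> K\<close>.\<close>
      moreover have "D I J"
        unfolding D_def eq using bound by (auto intro!: bdd_aboveI)
      ultimately have "coord_sum x J - coord_sum x I \<le> g I J"
        by (rule x)
      moreover have "g I J \<le> K"
        unfolding g_def eq by (rule cSUP_least[OF nonempty bound])
      ultimately have "(\<Sum>v\<in>B. x $ v - x $ \<sigma> v) \<le> K"
        unfolding eq by (rule order_trans)
      moreover have "(\<Sum>v\<in>V. c v (\<sigma> v)) = (\<Sum>v\<in>V - B. c1 v (\<sigma> v)) + (\<Sum>v\<in>B. d v (\<sigma> v))"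
        unfolding split c_def by (auto simp: B_def intro!: arg_cong2[of _ _ _ _ "(+)"] sum.cong)
      then have "(\<Sum>v\<in>V. c v (\<sigma> v)) = K - (\<Sum>v\<in>B. x $ v - x $ \<sigma> v)"
        by (simp add: d_def K_def sum.distrib sum_subtractf algebra_simps)
      ultimately show ?thesis
        by simp
    qed
    then obtain y where y: "\<And>u v. E u v \<Longrightarrow> y v - y u \<le> c u v"
      using feasible_potential[of E c] by blast
    \<comment> \<open>\<open>c\<close> never exceeds the cost of an arc that is present, so
      \<open>y\<close> satisfies the constraints of both sets.\<close>
    have "y v - y u \<le> c1 u v" if "E1 u v" for u v
      by (rule order_trans[OF y]) (use that in \<open>auto simp: E_def c_def A_def\<close>)
    then have "(\<chi> i. y i) \<in> S1"
      by (simp add: S1)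
    moreover have "y v - y u \<le> d u v" if "E2 v u" for u v
      by (rule order_trans[OF y]) (use that in \<open>auto simp: E_def c_def A_def\<close>)
    then have "(x $ j - y j) - (x $ i - y i) \<le> c2 i j" if "E2 i j" for i j
      using that by (fastforce simp: d_def algebra_simps)
    then have "x - (\<chi> i. y i) \<in> S2"
      by (simp add: S2)
    ultimately have "(\<chi> i. y i) + (x - (\<chi> i. y i)) \<in> S1 + S2"
      by (rule set_plus_intro)
    then show ?thesis
      by simp
  qed
  have valid: "coord_sum x J - coord_sum x I \<le> g I J" if "x \<in> S1 + S2" "D I J" for x I J
    using that unfolding D_def g_def by (intro cSUP_upper)
  show thesis
  proof (rule that[of D g], intro set_eqI iffI CollectI allI impI)
    show "x \<in> S1 + S2" if "x \<in> {x. \<forall>I J. card I = card J \<and> I \<inter> J = {} \<longrightarrow> D I J \<longrightarrow>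
        coord_sum x J - coord_sum x I \<le> g I J}" for x
      using that by (intro complete) simp
  qed (rule valid)
qed

section \<open>Specialization to the integers and the reals\<close>

lemma L_closed_if_L_convex_set:
  assumes "L_convex_set S"
  shows "L_closed S"
proof -
  have "x \<in> S" if x: "\<forall>e>0. \<exists>y\<in>S. \<forall>i. \<bar>y $ i - x $ i\<bar> < e" for x
  proof -
    obtain y where "y \<in> S" "\<forall>i. \<bar>y $ i - x $ i\<bar> < 1"
      using x zero_less_one by blast
    then have "y = x"
      by (simp add: vec_eq_iff)
    then show ?thesis
      using \<open>y \<in> S\<close> by simp
  qed
  then show ?thesis
    using assms by (auto simp: L_closed_def L_convex_set_def)
qed

lemma L_closed_if_L_convex_polyhedron:
  assumes "L_convex_polyhedron (P :: (real ^ 'n) set)"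
  shows "L_closed P"
proof -
  have "x \<in> P" if x: "\<forall>e>0. \<exists>y\<in>P. \<forall>i. \<bar>y $ i - x $ i\<bar> < e" for x
  proof -
    have "\<exists>y\<in>P. dist y x < e" if "0 < e" for e
    proof -
      \<comment> \<open>Coordinatewise errors below this value keep the l1 norm, which dominates the
        Euclidean norm, below \<open>e\<close>.\<close>
      have "0 < e / CARD('n)"
        using that by simp
      then obtain y where y: "y \<in> P" "\<And>i. \<bar>y $ i - x $ i\<bar> < e / CARD('n)"
        using x by blast
      have "dist y x \<le> (\<Sum>i\<in>UNIV. \<bar>y $ i - x $ i\<bar>)"
        using norm_le_l1_cart[of "y - x"] by (simp add: dist_norm)
      also have "\<dots> < (\<Sum>i\<in>(UNIV :: 'n set). e / CARD('n))"
        using y(2) by (intro sum_strict_mono) auto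
      finally show ?thesis
        using y(1) by auto
    qed
    then have "x \<in> closure P"
      by (simp add: closure_approachable)
    moreover have "closed P"
      using assms by (simp add: L_convex_polyhedron_def polyhedron_imp_closed)
    ultimately show ?thesis
      by simp
  qed
  then show ?thesis
    using assms by (auto simp: L_closed_def L_convex_polyhedron_def)
qed

theorem theorem3p1:
  shows "(\<forall>S :: (int ^ 'n) set. L2_convex_set S \<longrightarrow>
      (\<exists>\<gamma> :: 'n set \<Rightarrow> 'n set \<Rightarrow> ereal.
        (\<forall>I J. card I = card J \<and> I \<inter> J = {} \<longrightarrow> \<gamma> I J \<in> insert \<infinity> (ereal ` \<int>)) \<and>
        S = {x. \<forall>I J. card I = card J \<and> I \<inter> J = {} \<longrightarrow>
                  ereal (of_int (coord_sum x J - coord_sum x I)) \<le> \<gamma> I J}))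
    \<and> (\<forall>P :: (real ^ 'n) set. L2_convex_polyhedron P \<longrightarrow>
      (\<exists>\<gamma> :: 'n set \<Rightarrow> 'n set \<Rightarrow> ereal.
        (\<forall>I J. card I = card J \<and> I \<inter> J = {} \<longrightarrow> \<gamma> I J \<in> insert \<infinity> (range ereal)) \<and>
        P = {x. \<forall>I J. card I = card J \<and> I \<inter> J = {} \<longrightarrow>
                  ereal (coord_sum x J - coord_sum x I) \<le> \<gamma> I J}))"
proof (intro conjI allI impI)
  fix S :: "(int ^ 'n) set"
  assume "L2_convex_set S"
  then obtain S1 S2 where S: "L_closed S1" "L_closed S2" "S = S1 + S2"
    unfolding L2_convex_set_def using L_closed_if_L_convex_set by blast
  obtain D g where "S1 + S2 = {x. \<forall>I J. card I = card J \<and> I \<inter> J = {} \<longrightarrow> D I J \<longrightarrow>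
      coord_sum x J - coord_sum x I \<le> g I J}"
    using L_closed_sum_description[OF S(1,2)] .
  with S(3) show "\<exists>\<gamma> :: 'n set \<Rightarrow> 'n set \<Rightarrow> ereal.
      (\<forall>I J. card I = card J \<and> I \<inter> J = {} \<longrightarrow> \<gamma> I J \<in> insert \<infinity> (ereal ` \<int>)) \<and>
      S = {x. \<forall>I J. card I = card J \<and> I \<inter> J = {} \<longrightarrow>
                ereal (of_int (coord_sum x J - coord_sum x I)) \<le> \<gamma> I J}"
    \<comment> \<open>An infinite \<open>\<gamma> I J\<close> switches off the constraints outside
      \<open>D\<close>. Keeping \<open>of_int\<close> of a difference intact lets the comparison
      reduce to one between integers.\<close>
    by (intro exI[of _ "\<lambda>I J. if D I J then ereal (of_int (g I J)) else \<infinity>"])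
      (auto simp del: of_int_diff)
next
  fix P :: "(real ^ 'n) set"
  assume "L2_convex_polyhedron P"
  then obtain P1 P2 where P: "L_closed P1" "L_closed P2" "P = P1 + P2"
    unfolding L2_convex_polyhedron_def using L_closed_if_L_convex_polyhedron by blast
  obtain D g where "P1 + P2 = {x. \<forall>I J. card I = card J \<and> I \<inter> J = {} \<longrightarrow> D I J \<longrightarrow>
      coord_sum x J - coord_sum x I \<le> g I J}"
    using L_closed_sum_description[OF P(1,2)] .
  with P(3) show "\<exists>\<gamma> :: 'n set \<Rightarrow> 'n set \<Rightarrow> ereal.
      (\<forall>I J. card I = card J \<and> I \<inter> J = {} \<longrightarrow> \<gamma> I J \<in> insert \<infinity> (range ereal)) \<and>
      P = {x. \<forall>I J. card I = card J \<and> I \<inter> J = {} \<longrightarrow>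
                ereal (coord_sum x J - coord_sum x I) \<le> \<gamma> I J}"
    by (intro exI[of _ "\<lambda>I J. if D I J then ereal (g I J) else \<infinity>"]) auto
qed

end
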